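(* Let $\pi\in S_\infty$ be a permutation with $\ell(\pi)=p>0$. Let $(r,s)$ be the lex largest inversion of $\pi$ and $\nu=\pi t_{rs}$. Then the numbers of bounded pairs satisfy $$\mathfrak F_{\pi}(\mathbf 1)=p\,\mathfrak F_{\nu}(\mathbf 1)+\sum_{\substack{1\le q<r\\ \ell(\pi)=\ell(\nu t_{qr})}}\mathfrak F_{\nu t_{qr}}(\mathbf 1),$$ with base case $\mathfrak F_{\mathrm{id}}(\mathbf 1)=1$.
   Context: $S_\infty$ is the group of permutations of $\{1,2,\dots\}$ fixing all but finitely many elements, with $(\pi\tau)(i)=\pi(\tau(i))$. $t_{ij}$ is the transposition of $i$ and $j$, and $s_i=t_{i,i+1}$. An inversion of $\pi$ is a pair $(i,j)$ with $i<j$ and $\pi(i)>\pi(j)$; $\ell(\pi)$ is the number of inversions. For $\pi\neq\mathrm{id}$ the lex largest inversion $(r,s)$ is the lexicographically largest inversion of $\pi$. $R(\pi)$ is the set of reduced words for $\pi$: tuples $(a_1,\dots,a_p)$ of positive integers with $p=\ell(\pi)$ and $s_{a_1}\cdots s_{a_p}=\pi$. A bounded pair for $\pi$ is a pair $(\mathbf a,\mathbf b)$ with $\mathbf a\in R(\pi)$ and $\mathbf b$ an integer word of the same length with $1\le b_i\le a_i$ for all $i$. $\mathfrak F_\pi(\mathbf 1)$ denotes the number of bounded pairs for $\pi$, i.e. $\mathfrak F_\pi(\mathbf 1)=\sum_{(a_1,\dots,a_p)\in R(\pi)}a_1a_2\cdots a_p$ (for $\pi=\mathrm{id}$, the value is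 $1$). *)

theory Defs
  imports Main "HOL-Combinatorics.Permutations"
begin

text \<open>
  Permutations of the positive integers are represented as functions on \<^typ>\<open>nat\<close>
  that fix the extra point \<open>0\<close>; the product \<open>\<pi>\<tau>\<close> is \<^term>\<open>\<pi> \<circ> \<tau>\<close> and \<open>t\<^sub>i\<^sub>j\<close> is
  the library function \<^const>\<open>transpose\<close>.
\<close>

definition S_inf :: "(nat \<Rightarrow> nat) set" where
  "S_inf = {\<pi>. \<pi> permutes {1..} \<and> finite {i. \<pi> i \<noteq> i}}"

definition simple_transp :: "nat \<Rightarrow> nat \<Rightarrow> nat" where
  "simple_transp i = transpose i (i + 1)"

definition inversions :: "(nat \<Rightarrow> nat) \<Rightarrow> (nat \<times> nat) set" where
  "inversions \<pi> = {(i, j). 1 \<le> i \<and> i < j \<and> \<pi> i > \<pi> j}"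

definition perm_length :: "(nat \<Rightarrow> nat) \<Rightarrow> nat" where
  "perm_length \<pi> = card (inversions \<pi>)"

definition lex_largest_inversion :: "(nat \<Rightarrow> nat) \<Rightarrow> nat \<Rightarrow> nat \<Rightarrow> bool" where
  "lex_largest_inversion \<pi> r s \<longleftrightarrow>
     (r, s) \<in> inversions \<pi> \<and>
     (\<forall>i j. (i, j) \<in> inversions \<pi> \<longrightarrow> i < r \<or> (i = r \<and> j \<le> s))"

definition word_prod :: "nat list \<Rightarrow> nat \<Rightarrow> nat" where
  "word_prod a = foldr (\<circ>) (map simple_transp a) id"

definition reduced_words :: "(nat \<Rightarrow> nat) \<Rightarrow> nat list set" where
  "reduced_words \<pi> =
     {a. (\<forall>x\<in>set a. 1 \<le> x) \<and> length a = perm_length \<pi> \<and> word_prod a = \<pi>}"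

definition bounded_pairs :: "(nat \<Rightarrow> nat) \<Rightarrow> (nat list \<times> nat list) set" where
  "bounded_pairs \<pi> =
     {(a, b). a \<in> reduced_words \<pi> \<and> length b = length a \<and>
              (\<forall>i<length a. 1 \<le> b ! i \<and> b ! i \<le> a ! i)}"

text \<open>
  For \<open>\<pi>\<close> in \<^const>\<open>S_inf\<close> the set of bounded pairs is finite: if \<open>\<pi>\<close> fixes every point
  larger than \<open>n\<close>, the letters of a reduced word for \<open>\<pi>\<close> are all less than \<open>n\<close>.
\<close>

definition num_bounded_pairs :: "(nat \<Rightarrow> nat) \<Rightarrow> nat" where
  "num_bounded_pairs \<pi> = card (bounded_pairs \<pi>)"

end

theory Submission imports Defs begin

text \<open>
  Write \<open>c(w)\<close> for the number of bounded pairs of \<open>w\<close>. Splitting off the first letter of a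
  reduced word gives \<open>c(w) = \<Sum>\<^sub>k k c(s\<^sub>k w)\<close>, summed over the left descents \<open>k\<close> of a
  permutation \<open>w \<noteq> id\<close>. From this recursion one obtains, by induction on the length, an
  analogue of Monk's rule for Schubert polynomials with all variables set to \<open>1\<close>: for every
  permutation \<open>w\<close> and every position \<open>r\<close>,

  \<open>(\<ell>(w) + 1) c(w) = \<Sum>\<^sub>j\<^sub>>\<^sub>r c(w t\<^sub>r\<^sub>j) - \<Sum>\<^sub>j\<^sub><\<^sub>r c(w t\<^sub>r\<^sub>j)\<close>,

  both sums running over those \<open>j\<close> for which \<open>w t\<^sub>r\<^sub>j\<close> covers \<open>w\<close>, that is, is longer by
  exactly one. To see this, expand every \<open>c(w t\<^sub>r\<^sub>j)\<close> on the right by its first letter. Unless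
  \<open>s\<^sub>k w = w t\<^sub>r\<^sub>j\<close>, the pair \<open>(k, j)\<close> contributes on this side exactly when it contributes
  to the right-hand side for the shorter permutation \<open>s\<^sub>k w\<close>
  (\<open>left_descent_cover_exchange\<close>), so by induction these terms add up to
  \<open>\<Sum>\<^sub>k k \<ell>(w) c(s\<^sub>k w) = \<ell>(w) c(w)\<close>. The exceptional pairs have
  \<open>{w(r), w(j)} = {k, k + 1}\<close>; whichever of \<open>w\<close> and \<open>s\<^sub>k w\<close> is longer and on whichever side
  of \<open>r\<close> the position \<open>j\<close> lies, they contribute \<open>w(r) c(w)\<close> for \<open>k = w(r)\<close> and
  \<open>-(w(r) - 1) c(w)\<close> for \<open>k = w(r) - 1\<close>, together \<open>c(w)\<close>
  (\<open>exceptional_terms_cancel\<close>).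

  The recurrence is this rule (\<open>monk_at_ones\<close>) for \<open>\<nu> = \<pi> t\<^sub>r\<^sub>s\<close>: since \<open>(r, s)\<close> is the lex
  largest inversion, \<open>\<pi>\<close> is increasing to the right of \<open>r\<close>, which leaves \<open>j = s\<close> as the only
  cover with \<open>j > r\<close> (\<open>lex_largest_inversion_covers\<close>).
\<close>

section \<open>Length and right multiplication by a transposition\<close>

lemma inversions_subset:
  assumes "w permutes {1..N}"
  shows "inversions w \<subseteq> {1..N} \<times> {1..N}"
proof
  fix p assume "p \<in> inversions w"
  then obtain i j where p: "p = (i, j)" "1 \<le> i" "i < j" "w i > w j"
    by (auto simp: inversions_def)
  have "j \<le> N"
  proof (rule ccontr)
    assume "\<not> j \<le> N"
    then have "w j = j" using assms by (auto simp: permutes_def)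
    moreover have "w i \<le> max i N"
      using permutes_in_image[OF assms, of i] permutes_not_in[OF assms, of i] by (cases "i \<in> {1..N}") auto
    ultimately show False using p \<open>\<not> j \<le> N\<close> by auto
  qed
  then show "p \<in> {1..N} \<times> {1..N}" using p by auto
qed

lemma finite_inversions: "w permutes {1..N} \<Longrightarrow> finite (inversions w)"
  by (rule finite_subset[OF inversions_subset]) auto

text \<open>
  Relabelling both entries of a pair of positions by \<open>t\<^sub>i\<^sub>j\<close> turns inversions of \<open>w\<close> into
  inversions of \<open>w t\<^sub>i\<^sub>j\<close>, except when the relabelling reverses the order of the pair; such a
  pair is kept as it is. This misses precisely \<open>(i, j)\<close> and the pairs \<open>(i, m)\<close>, \<open>(m, j)\<close> with
  \<open>m\<close> lying between \<open>i\<close> and \<open>j\<close> both in position and in value.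
\<close>

lemma perm_length_comp_transpose:
  assumes inj: "inj w" and fin: "finite (inversions w)"
    and ij: "1 \<le> i" "i < j" and less: "w i < w j"
  shows "perm_length (w \<circ> transpose i j) =
    perm_length w + 1 + 2 * card {m. i < m \<and> m < j \<and> w i < w m \<and> w m < w j}"
proof -
  define B where "B = {m. i < m \<and> m < j \<and> w i < w m \<and> w m < w j}"
  \<comment> \<open>the inversions created by the exchange\<close>
  define D where "D = insert (i, j) (({i} \<times> B) \<union> (B \<times> {j}))"
  define t where "t = transpose i j"
  define f where "f = (\<lambda>(x, y). if t x < t y then (t x, t y) else (x, y))"
  have finB: "finite B" by (rule finite_subset[of _ "{..j}"]) (auto simp: B_def)
  have tt: "t (t x) = x" for x by (simp add: t_def)
  have ff: "f (f p) = p" if "fst p < snd p" for p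
    using that by (auto simp: f_def tt split: prod.splits if_splits)
  have inj_f: "inj_on f (inversions w)"
    by (rule inj_on_inverseI[of _ f]) (auto simp: inversions_def intro: ff)
  have key: "(x, y) \<in> inversions (w \<circ> t) \<longleftrightarrow> f (x, y) \<in> inversions w \<or> (x, y) \<in> D"
    and disj: "f (x, y) \<in> inversions w \<Longrightarrow> (x, y) \<notin> D" if "1 \<le> x" "x < y" for x y
  proof -
    have ne: "w a = w b \<longleftrightarrow> a = b" for a b using inj by (auto dest: injD)
    show "(x, y) \<in> inversions (w \<circ> t) \<longleftrightarrow> f (x, y) \<in> inversions w \<or> (x, y) \<in> D"
      using that ij less ne[of x i] ne[of x j] ne[of y i] ne[of y j]
      by (auto simp: D_def B_def f_def t_def transpose_def inversions_def split: if_splits)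
    show "f (x, y) \<in> inversions w \<Longrightarrow> (x, y) \<notin> D"
      using that ij less
      by (auto simp: D_def B_def f_def t_def transpose_def inversions_def split: if_splits)
  qed
  have pos: "fst p \<ge> 1 \<and> fst p < snd p" if "p \<in> inversions v" for p v
    using that by (auto simp: inversions_def)
  have posD: "fst p \<ge> 1 \<and> fst p < snd p" if "p \<in> D" for p
    using that ij by (auto simp: D_def B_def)
  have posf: "fst (f p) \<ge> 1 \<and> fst (f p) < snd (f p)" if "fst p \<ge> 1 \<and> fst p < snd p" for p
    using that ij by (auto simp: f_def t_def transpose_def split: prod.splits if_splits)
  have eq: "inversions (w \<circ> t) = f ` inversions w \<union> D"
  proof (intro equalityI subsetI)
    fix p assume p: "p \<in> inversions (w \<circ> t)"
    have "f p \<in> inversions w \<or> p \<in> D"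
      using key[of "fst p" "snd p"] pos[OF p] p by auto
    then show "p \<in> f ` inversions w \<union> D"
      using ff[of p] pos[OF p] by (metis UnI1 UnI2 imageI)
  next
    fix p assume p: "p \<in> f ` inversions w \<union> D"
    then consider q where "q \<in> inversions w" "p = f q" | "p \<in> D" by auto
    then show "p \<in> inversions (w \<circ> t)"
    proof cases
      case 1
      then have "f p \<in> inversions w" using ff pos by auto
      then show ?thesis using key[of "fst p" "snd p"] posf[of q] pos 1 by auto
    next
      case 2
      then show ?thesis using key[of "fst p" "snd p"] posD[OF 2] by auto
    qed
  qed
  have dj: "f ` inversions w \<inter> D = {}"
  proof -
    have "f q \<notin> D" if q: "q \<in> inversions w" for q
      using disj[of "fst (f q)" "snd (f q)"] posf[of q] pos[OF q] ff[of q] q by auto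
    then show ?thesis by auto
  qed
  have "card D = 1 + 2 * card B"
  proof -
    have "({i} \<times> B) \<inter> (B \<times> {j}) = {}" by (auto simp: B_def)
    moreover have "(i, j) \<notin> ({i} \<times> B) \<union> (B \<times> {j})" by (auto simp: B_def)
    ultimately show ?thesis
      unfolding D_def using finB by (simp add: card_Un_disjoint card_cartesian_product)
  qed
  moreover have "finite D" using finB by (simp add: D_def)
  ultimately have "card (inversions (w \<circ> t)) = card (inversions w) + (1 + 2 * card B)"
    unfolding eq using dj fin inj_f by (simp add: card_Un_disjoint card_image)
  then show ?thesis by (simp add: perm_length_def t_def B_def)
qed

lemma permutes_pos_iff: "w permutes {1..N} \<Longrightarrow> 1 \<le> w i \<longleftrightarrow> 1 \<le> (i::nat)"
  using permutes_in_image[of w "{1..N}" i] permutes_not_in[of w "{1..N}" i]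
  by (cases "i \<in> {1..N}") auto

lemma permutes_comp_transpose:
  "w permutes {1..N} \<Longrightarrow> 1 \<le> i \<Longrightarrow> i \<le> M \<Longrightarrow> 1 \<le> j \<Longrightarrow> j \<le> M \<Longrightarrow> N \<le> M \<Longrightarrow>
    w \<circ> transpose i j permutes {1..M}" for M :: nat
  by (rule permutes_compose[OF permutes_swap_id permutes_subset[where S = "{1..N}"]]) auto

lemma perm_length_cover_iff:
  assumes w: "w permutes {1..N}" and ij: "1 \<le> i" "i < j"
  shows "perm_length (w \<circ> transpose i j) = perm_length w + 1 \<longleftrightarrow>
    w i < w j \<and> (\<forall>m. i < m \<longrightarrow> m < j \<longrightarrow> \<not> (w i < w m \<and> w m < w j))"
proof (cases "w i < w j")
  case True
  have "finite {m. i < m \<and> m < j \<and> w i < w m \<and> w m < w j}"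
    by (rule finite_subset[of _ "{..j}"]) auto
  then show ?thesis
    using perm_length_comp_transpose[OF permutes_inj[OF w] finite_inversions[OF w] ij True] True
    by (auto simp: card_eq_0_iff)
next
  case False
  moreover have "w i \<noteq> w j" using permutes_inj[OF w] ij by (auto dest: injD)
  ultimately have less: "w j < w i" by simp
  define v where "v = w \<circ> transpose i j"
  have v: "v permutes {1..max N j}"
    unfolding v_def using w ij by (intro permutes_comp_transpose) auto
  have "perm_length (v \<circ> transpose i j) \<ge> perm_length v + 1"
    using perm_length_comp_transpose[OF permutes_inj[OF v] finite_inversions[OF v] ij] less
    by (simp add: v_def)
  moreover have "v \<circ> transpose i j = w" by (simp add: v_def comp_assoc)
  ultimately show ?thesis using False by (simp add: v_def)
qed

lemma simple_transp_involutory [simp]: "simple_transp k \<circ> (simple_transp k \<circ> w) = w"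
  by (simp add: simple_transp_def flip: comp_assoc)

lemma simple_transp_comp:
  assumes "inj w" "w x = k" "w y = k + 1"
  shows "simple_transp k \<circ> w = w \<circ> transpose x y"
proof
  fix z
  have "w z = w x \<longleftrightarrow> z = x" "w z = w y \<longleftrightarrow> z = y" using assms(1) by (auto dest: injD)
  then show "(simple_transp k \<circ> w) z = (w \<circ> transpose x y) z"
    using assms(2,3) by (auto simp: simple_transp_def transpose_def)
qed

lemma perm_length_simple_transp_comp:
  assumes w: "w permutes {1..N}" and k: "1 \<le> k" and x: "w x = k" and y: "w y = k + 1" and "x < y"
  shows "perm_length (simple_transp k \<circ> w) = perm_length w + 1"
  using perm_length_cover_iff[OF w _ \<open>x < y\<close>] permutes_pos_iff[OF w, of x] assms
  by (simp add: simple_transp_comp[OF permutes_inj[OF w] x y])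

lemma simple_transp_comp_permutes:
  "w permutes {1..N} \<Longrightarrow> 1 \<le> k \<Longrightarrow> k < M \<Longrightarrow> N \<le> M \<Longrightarrow> simple_transp k \<circ> w permutes {1..M}" for M :: nat
  unfolding simple_transp_def
  by (rule permutes_compose[OF permutes_subset[where S = "{1..N}"] permutes_swap_id]) auto

section \<open>Left descents\<close>

definition left_descent :: "(nat \<Rightarrow> nat) \<Rightarrow> nat \<Rightarrow> bool" where
  "left_descent w k \<longleftrightarrow> perm_length (simple_transp k \<circ> w) < perm_length w"

lemma left_descent_iff:
  assumes w: "w permutes {1..N}" and k: "1 \<le> k" and x: "w x = k" and y: "w y = k + 1"
  shows "left_descent w k \<longleftrightarrow> y < x"
    and "perm_length (simple_transp k \<circ> w) =
      (if left_descent w k then perm_length w - 1 else perm_length w + 1)"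
    and "left_descent w k \<Longrightarrow> 0 < perm_length w"
proof -
  have "perm_length w = perm_length (simple_transp k \<circ> w) + 1" if "y < x"
  proof -
    have "simple_transp k \<circ> w permutes {1..max N (k + 1)}"
      using w k by (intro simple_transp_comp_permutes) auto
    from perm_length_simple_transp_comp[OF this k _ _ that] show ?thesis
      using x y by (simp add: simple_transp_def flip: comp_assoc)
  qed
  moreover have "x \<noteq> y" using x y by auto
  moreover note perm_length_simple_transp_comp[OF w k x y]
  ultimately have "y < x \<and> perm_length w = perm_length (simple_transp k \<circ> w) + 1 \<or>
      x < y \<and> perm_length (simple_transp k \<circ> w) = perm_length w + 1"
    by linarith
  then show "left_descent w k \<longleftrightarrow> y < x"
    "perm_length (simple_transp k \<circ> w) =
      (if left_descent w k then perm_length w - 1 else perm_length w + 1)"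
    "left_descent w k \<Longrightarrow> 0 < perm_length w"
    by (auto simp: left_descent_def)
qed

lemma perm_length_simple_transp_cases:
  assumes w: "w permutes {1..N}" and k: "1 \<le> k"
  shows "perm_length (simple_transp k \<circ> w) =
      (if left_descent w k then perm_length w - 1 else perm_length w + 1)"
    and "left_descent w k \<Longrightarrow> 0 < perm_length w"
proof -
  obtain x y where "w x = k" "w y = k + 1"
    using permutes_surj[OF w] by (metis surj_def)
  then show "perm_length (simple_transp k \<circ> w) =
      (if left_descent w k then perm_length w - 1 else perm_length w + 1)"
    "left_descent w k \<Longrightarrow> 0 < perm_length w"
    using left_descent_iff[OF w k] by blast+
qed

lemma left_descent_less:
  assumes w: "w permutes {1..N}" and k: "1 \<le> k" and d: "left_descent w k"
  shows "k < N"
proof (rule ccontr)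
  assume "\<not> k < N"
  obtain x y where x: "w x = k" and y: "w y = k + 1"
    using permutes_surj[OF w] by (metis surj_def)
  have "y = k + 1"
  proof (rule injD[OF permutes_inj[OF w]])
    show "w y = w (k + 1)" unfolding y
      by (rule permutes_not_in[OF w, symmetric]) (use \<open>\<not> k < N\<close> in auto)
  qed
  moreover have "x \<le> k"
  proof (cases "x \<in> {1..N}")
    case True
    then have "k \<in> {1..N}" using x permutes_in_image[OF w, of x] by simp
    then show ?thesis using True \<open>\<not> k < N\<close> by simp
  next
    case False
    then show ?thesis using x permutes_not_in[OF w False] by simp
  qed
  ultimately show False using left_descent_iff(1)[OF w k x y] d by simp
qed

section \<open>Splitting off the first letter of a reduced word\<close>

lemma word_prod_Nil: "word_prod [] = id"
  by (simp add: word_prod_def)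

lemma word_prod_Cons: "word_prod (k # as) = simple_transp k \<circ> word_prod as"
  by (simp add: word_prod_def)

lemma word_prod_permutes:
  "\<forall>x\<in>set as. 1 \<le> x \<Longrightarrow> \<exists>N. word_prod as permutes {1..N}"
proof (induction as)
  case Nil
  show ?case unfolding word_prod_Nil by (rule exI[of _ 0]) (rule permutes_id)
next
  case (Cons k as)
  then obtain N where "word_prod as permutes {1..N}" by auto
  then have "word_prod (k # as) permutes {1..max N (k + 1)}"
    unfolding word_prod_Cons using Cons.prems by (intro simple_transp_comp_permutes) auto
  then show ?case by blast
qed

lemma perm_length_id [simp]: "perm_length id = 0"
proof -
  have "inversions id = {}" by (auto simp: inversions_def)
  then show ?thesis by (simp add: perm_length_def)
qed

lemma perm_length_word_prod_le:
  "\<forall>x\<in>set as. 1 \<le> x \<Longrightarrow> perm_length (word_prod as) \<le> length as"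
proof (induction as)
  case Nil
  show ?case unfolding word_prod_Nil perm_length_id by (rule le0)
next
  case (Cons k as)
  then obtain N where "word_prod as permutes {1..N}" using word_prod_permutes by fastforce
  then have "perm_length (simple_transp k \<circ> word_prod as) \<le> perm_length (word_prod as) + 1"
    using Cons.prems perm_length_simple_transp_cases(1)[of "word_prod as" N k]
    by (cases "left_descent (word_prod as) k") auto
  moreover have "perm_length (word_prod as) \<le> length as" using Cons by simp
  ultimately show ?case unfolding word_prod_Cons list.size by linarith
qed

text \<open>
  The first letter \<open>k\<close> of a reduced word must be a left descent: the remaining letters show that
  \<open>s\<^sub>k w\<close> has a word with fewer than \<open>\<ell>(w)\<close> letters, and a permutation has no word shorter than
  its length.
\<close>

lemma Cons_in_reduced_words_iff:
  assumes w: "w permutes {1..N}"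
  shows "k # as \<in> reduced_words w \<longleftrightarrow>
    1 \<le> k \<and> left_descent w k \<and> as \<in> reduced_words (simple_transp k \<circ> w)"
proof -
  have prod: "word_prod (k # as) = w \<longleftrightarrow> word_prod as = simple_transp k \<circ> w"
    by (metis word_prod_Cons simple_transp_involutory)
  show ?thesis
  proof
    assume red: "k # as \<in> reduced_words w"
    then have k: "1 \<le> k" and letters: "\<forall>x\<in>set as. 1 \<le> x"
      and len: "Suc (length as) = perm_length w" and as: "word_prod as = simple_transp k \<circ> w"
      using prod by (auto simp: reduced_words_def)
    have "perm_length (simple_transp k \<circ> w) \<le> length as"
      using perm_length_word_prod_le[OF letters] as by simp
    then have "left_descent w k" using len by (simp add: left_descent_def)
    then show "1 \<le> k \<and> left_descent w k \<and> as \<in> reduced_words (simple_transp k \<circ> w)"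
      using perm_length_simple_transp_cases(1)[OF w k] k letters as len
      by (auto simp: reduced_words_def)
  next
    assume "1 \<le> k \<and> left_descent w k \<and> as \<in> reduced_words (simple_transp k \<circ> w)"
    then show "k # as \<in> reduced_words w"
      using perm_length_simple_transp_cases[OF w, of k] prod
      by (auto simp: reduced_words_def)
  qed
qed

definition cons_pair :: "nat \<times> nat \<times> nat list \<times> nat list \<Rightarrow> nat list \<times> nat list" where
  "cons_pair = (\<lambda>(k, x, a, b). (k # a, x # b))"

lemma inj_cons_pair: "inj_on cons_pair A"
  by (auto simp: cons_pair_def inj_on_def)

lemma bounded_pairs_first_letter:
  assumes w: "w permutes {1..N}" and pos: "0 < perm_length w"
  shows "bounded_pairs w =
    cons_pair ` (SIGMA k:{k. 1 \<le> k \<and> left_descent w k}. {1..k} \<times> bounded_pairs (simple_transp k \<circ> w))"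
proof (intro equalityI subsetI)
  fix p assume p: "p \<in> bounded_pairs w"
  then obtain a b where ab: "p = (a, b)" "a \<in> reduced_words w" "length b = length a"
    "\<forall>i<length a. 1 \<le> b ! i \<and> b ! i \<le> a ! i" by (auto simp: bounded_pairs_def)
  obtain k as where a: "a = k # as" using ab pos by (cases a) (auto simp: reduced_words_def)
  obtain x bs where b: "b = x # bs" using ab a by (cases b) auto
  have "1 \<le> x" "x \<le> k" using ab(4)[rule_format, of 0] a b by auto
  moreover have "\<forall>i<length as. 1 \<le> bs ! i \<and> bs ! i \<le> as ! i"
    using ab(4)[rule_format, of "Suc i" for i] a b by auto
  ultimately show "p \<in> cons_pair ` (SIGMA k:{k. 1 \<le> k \<and> left_descent w k}.
      {1..k} \<times> bounded_pairs (simple_transp k \<circ> w))"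
    using ab a b Cons_in_reduced_words_iff[OF w, of k as]
    by (auto simp: bounded_pairs_def cons_pair_def image_iff)
next
  fix p assume "p \<in> cons_pair ` (SIGMA k:{k. 1 \<le> k \<and> left_descent w k}.
      {1..k} \<times> bounded_pairs (simple_transp k \<circ> w))"
  then show "p \<in> bounded_pairs w"
    using Cons_in_reduced_words_iff[OF w]
    by (auto simp: bounded_pairs_def cons_pair_def nth_Cons split: nat.splits)
qed

lemma finite_left_descents: "w permutes {1..N} \<Longrightarrow> finite {k. 1 \<le> k \<and> left_descent w k}"
  using left_descent_less by (force intro: finite_subset[of _ "{..<N}"])

lemma finite_bounded_pairs: "w permutes {1..N} \<Longrightarrow> finite (bounded_pairs w)"
proof (induction "perm_length w" arbitrary: w)
  case 0
  then have "bounded_pairs w \<subseteq> {([], [])}"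
    by (auto simp: bounded_pairs_def reduced_words_def)
  then show ?case by (rule finite_subset) simp
next
  case (Suc n)
  have "finite (bounded_pairs (simple_transp k \<circ> w))" if "1 \<le> k" "left_descent w k" for k
  proof (rule Suc.hyps(1))
    show "n = perm_length (simple_transp k \<circ> w)"
      using perm_length_simple_transp_cases(1)[OF Suc.prems that(1)] that Suc.hyps(2) by simp
    show "simple_transp k \<circ> w permutes {1..N}"
      using Suc.prems that left_descent_less by (intro simple_transp_comp_permutes) auto
  qed
  then show ?case
    unfolding bounded_pairs_first_letter[OF Suc.prems, unfolded Suc.hyps(2)[symmetric], OF zero_less_Suc]
    using finite_left_descents[OF Suc.prems] by (intro finite_imageI finite_SigmaI) auto
qed

lemma num_bounded_pairs_first_letter:
  assumes w: "w permutes {1..Suc N}" and pos: "0 < perm_length w"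
  shows "num_bounded_pairs w =
    (\<Sum>k = 1..N. if left_descent w k then k * num_bounded_pairs (simple_transp k \<circ> w) else 0)"
proof -
  let ?K = "{k. 1 \<le> k \<and> left_descent w k}"
  have "finite (bounded_pairs (simple_transp k \<circ> w))" if "k \<in> ?K" for k
    using that w left_descent_less
    by (intro finite_bounded_pairs[of _ "Suc N"] simple_transp_comp_permutes) auto
  then have "num_bounded_pairs w = (\<Sum>k\<in>?K. k * num_bounded_pairs (simple_transp k \<circ> w))"
    unfolding num_bounded_pairs_def bounded_pairs_first_letter[OF w pos] card_image[OF inj_cons_pair]
    using finite_left_descents[OF w]
    by (subst card_SigmaI) (auto simp: card_cartesian_product)
  also have "?K = {k \<in> {1..N}. left_descent w k}"
    using left_descent_less[OF w] by force
  also have "(\<Sum>k\<in>\<dots>. k * num_bounded_pairs (simple_transp k \<circ> w)) =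
    (\<Sum>k = 1..N. if left_descent w k then k * num_bounded_pairs (simple_transp k \<circ> w) else 0)"
    by (rule sum.inter_filter) simp
  finally show ?thesis .
qed

lemma num_bounded_pairs_id: "num_bounded_pairs id = 1"
proof -
  have "bounded_pairs id = {([], [])}"
    by (auto simp: bounded_pairs_def reduced_words_def word_prod_Nil)
  then show ?thesis by (simp add: num_bounded_pairs_def)
qed

section \<open>Left descents of a cover\<close>

text \<open>
  Passing to the cover \<open>w t\<^sub>i\<^sub>j\<close> creates no left descent \<open>k\<close>, apart from the obvious one that
  arises when the exchanged values are \<open>k\<close> and \<open>k + 1\<close> themselves. If only one of these values
  moves, it could overtake the other in the required direction only if the latter were to lie
  between \<open>i\<close> and \<open>j\<close> both in position and in value, and then \<open>w t\<^sub>i\<^sub>j\<close> would not be a cover.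
  The converse inclusion fails: a cover can lose left descents.
\<close>

lemma left_descent_cover:
  assumes w: "w permutes {1..N}" and ij: "1 \<le> i" "1 \<le> j" and k: "1 \<le> k"
    and cover: "perm_length (w \<circ> transpose i j) = perm_length w + 1"
    and ne: "simple_transp k \<circ> w \<noteq> w \<circ> transpose i j"
    and des: "left_descent (w \<circ> transpose i j) k"
  shows "left_descent w k"
proof -
  have wlog: "left_descent w k"
    if ij: "1 \<le> i" "i < j" and cover: "perm_length (w \<circ> transpose i j) = perm_length w + 1"
    and ne: "simple_transp k \<circ> w \<noteq> w \<circ> transpose i j"
    and des: "left_descent (w \<circ> transpose i j) k" for i j
  proof -
    obtain x y where x: "w x = k" and y: "w y = k + 1"
      using permutes_surj[OF w] by (metis surj_def)
    define t where "t = transpose i j"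
    have tt: "t (t z) = z" for z by (simp add: t_def)
    have wt: "w \<circ> t permutes {1..max N j}"
      unfolding t_def using w ij by (intro permutes_comp_transpose) auto
    have moved: "t y < t x"
      using left_descent_iff(1)[OF wt k, of "t x" "t y"] des x y by (simp add: tt flip: t_def)
    have btw: "w i < w j" "\<And>m. i < m \<Longrightarrow> m < j \<Longrightarrow> \<not> (w i < w m \<and> w m < w j)"
      using perm_length_cover_iff[OF w ij] cover by auto
    have not_ij: "\<not> (x = i \<and> y = j)"
      using ne simple_transp_comp[OF permutes_inj[OF w] x y] by auto
    have inj: "w a = w b \<Longrightarrow> a = b" for a b using permutes_inj[OF w] by (rule injD)
    have "x \<noteq> y" using x y by auto
    consider "x = i" | "x = j" | "x \<noteq> i" "x \<noteq> j" "y = i" | "x \<noteq> i" "x \<noteq> j" "y = j"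
      | "x \<noteq> i" "x \<noteq> j" "y \<noteq> i" "y \<noteq> j" by blast
    then have "y < x"
    proof cases
      case 1
      then have "w j \<noteq> k + 1" using not_ij inj[of j y] y by auto
      then have "\<not> (i < y \<and> y < j)" using btw(1) btw(2)[of y] 1 x y by auto
      moreover have "y < j" using moved 1 \<open>x \<noteq> y\<close> not_ij by (auto simp: t_def)
      ultimately show ?thesis using 1 \<open>x \<noteq> y\<close> by simp
    next
      case 2
      then have "y \<noteq> i" using btw(1) x y by auto
      then show ?thesis using moved 2 \<open>x \<noteq> y\<close> ij by (auto simp: t_def)
    next
      case 3
      then show ?thesis using moved ij by (auto simp: t_def)
    next
      case 4
      then have "w i \<noteq> k" using inj[of i x] x by auto
      then have "\<not> (i < x \<and> x < j)" using btw(1) btw(2)[of x] 4 x y by auto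
      then show ?thesis using moved 4 by (auto simp: t_def)
    next
      case 5
      then show ?thesis using moved by (simp add: t_def)
    qed
    then show ?thesis using left_descent_iff(1)[OF w k x y] by simp
  qed
  have "i \<noteq> j" using cover by auto
  then consider "i < j" | "j < i" by linarith
  then show ?thesis
  proof cases
    case 1
    then show ?thesis using wlog[of i j] ij cover ne des by blast
  next
    case 2
    then show ?thesis using wlog[of j i] ij cover ne des by (simp add: transpose_commute)
  qed
qed

lemma left_descent_simple_transp_comp:
  assumes "w permutes {1..N}" "1 \<le> k"
  shows "left_descent (simple_transp k \<circ> w) k \<longleftrightarrow> \<not> left_descent w k"
  using perm_length_simple_transp_cases[OF assms]
  by (auto simp: left_descent_def[of "simple_transp k \<circ> w"] split: if_splits)

text \<open>
  The two sides describe the terms \<open>c(s\<^sub>k w t\<^sub>i\<^sub>j)\<close> that occur when first the cover and then the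
  letter is chosen, and in the opposite order. Either direction is \<open>left_descent_cover\<close>, for \<open>w\<close> and
  for \<open>s\<^sub>k w\<close> respectively; all lengths involved then follow.
\<close>

lemma left_descent_cover_exchange:
  assumes w: "w permutes {1..N}" and ij: "1 \<le> i" "1 \<le> j" and k: "1 \<le> k"
    and ne: "simple_transp k \<circ> w \<noteq> w \<circ> transpose i j"
  shows "perm_length (w \<circ> transpose i j) = perm_length w + 1 \<and> left_descent (w \<circ> transpose i j) k
    \<longleftrightarrow> left_descent w k \<and>
      perm_length (simple_transp k \<circ> w \<circ> transpose i j) = perm_length (simple_transp k \<circ> w) + 1"
    (is "?A \<longleftrightarrow> ?B")
proof -
  define M where "M = N + i + j + k + 1"
  have wt: "w \<circ> transpose i j permutes {1..M}"
    using w ij k by (intro permutes_comp_transpose) (auto simp: M_def)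
  have u: "simple_transp k \<circ> w permutes {1..M}"
    using w ij k by (intro simple_transp_comp_permutes) (auto simp: M_def)
  note len = perm_length_simple_transp_cases[OF w k] perm_length_simple_transp_cases[OF wt k]
  note desc = left_descent_simple_transp_comp[OF w k] left_descent_simple_transp_comp[OF wt k]
  show ?thesis
  proof
    assume A: ?A
    then have "left_descent w k" using left_descent_cover[OF w ij k _ ne] by blast
    then show ?B using A len by (simp add: comp_assoc)
  next
    assume B: ?B
    have "simple_transp k \<circ> (simple_transp k \<circ> w) \<noteq> simple_transp k \<circ> w \<circ> transpose i j"
      using ne by (metis comp_assoc simple_transp_involutory)
    then have "\<not> left_descent (simple_transp k \<circ> w \<circ> transpose i j) k"
      using left_descent_cover[OF u ij k] B desc by blast
    then have "left_descent (w \<circ> transpose i j) k" using desc by (simp add: comp_assoc)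
    then show ?A using B len by (auto simp: comp_assoc)
  qed
qed

section \<open>Monk's rule at all variables equal to one\<close>

definition side :: "nat \<Rightarrow> nat \<Rightarrow> int" where
  "side r j = (if r < j then 1 else - 1)"

text \<open>
  For a permutation of \<open>{1..N}\<close> and \<open>r \<le> N\<close>, every cover \<open>w t\<^sub>r\<^sub>j\<close> has \<open>j \<le> N + 1\<close>. Fixing this
  range, instead of letting it depend on \<open>w\<close>, makes the sums for \<open>w\<close> and \<open>s\<^sub>k w\<close> comparable
  term by term.
\<close>

definition signed_covers :: "nat \<Rightarrow> nat \<Rightarrow> (nat \<Rightarrow> nat) \<Rightarrow> int" where
  "signed_covers N r w = (\<Sum>j = 1..Suc N.
    if perm_length (w \<circ> transpose r j) = perm_length w + 1
    then side r j * int (num_bounded_pairs (w \<circ> transpose r j)) else 0)"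

text \<open>
  If \<open>s\<^sub>k w = w t\<^sub>r\<^sub>j\<close>, then \<open>k\<close> is a left descent of \<open>w\<close> according to the order in which the values
  \<open>k\<close> and \<open>k + 1\<close> occur, and the side of \<open>r\<close> on which \<open>j\<close> lies is determined by the same order.
  The two signs therefore combine to \<open>+\<close> when \<open>w(r) = k\<close> and to \<open>-\<close> when \<open>w(r) = k + 1\<close>, so that
  the sum is \<open>w(r) - (w(r) - 1)\<close>. If \<open>w(r) = 1\<close> the second term is absent, in agreement with its
  weight \<open>0\<close>.
\<close>

lemma exceptional_terms_cancel:
  assumes w: "w permutes {1..N}" and r: "1 \<le> r" "r \<le> N"
  shows "(\<Sum>j = 1..Suc N. \<Sum>k = 1..N. if simple_transp k \<circ> w = w \<circ> transpose r j
      then side r j * (if left_descent w k then - int k else int k) else 0) = 1"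
proof -
  have w': "w permutes {1..Suc N}" by (rule permutes_subset[OF w]) auto
  have "w r \<in> {1..N}" using permutes_in_image[OF w, of r] r by simp
  then have wr: "1 \<le> w r" "w r \<le> N" by auto
  let ?g = "\<lambda>y k. (if k = w r \<and> y = k + 1 then int k else 0) -
    (if y = k \<and> w r = k + 1 then int k else 0)"
  have term_eq: "(if simple_transp k \<circ> w = w \<circ> transpose r j
      then side r j * (if left_descent w k then - int k else int k) else 0) = ?g (w j) k"
    if k: "1 \<le> k" for j k
  proof -
    consider "w r = k" "w j = k + 1" | "w j = k" "w r = k + 1"
      | "\<not> (w r = k \<and> w j = k + 1)" "\<not> (w j = k \<and> w r = k + 1)" by blast
    then show ?thesis
    proof cases
      case 1
      then have "r \<noteq> j" by auto
      then show ?thesis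
        using 1 simple_transp_comp[OF permutes_inj[OF w] 1] left_descent_iff(1)[OF w k 1]
        by (auto simp: side_def)
    next
      case 2
      then have "r \<noteq> j" by auto
      then show ?thesis
        using 2 simple_transp_comp[OF permutes_inj[OF w] 2] left_descent_iff(1)[OF w k 2]
        by (auto simp: side_def transpose_commute)
    next
      case 3
      have "simple_transp k \<circ> w \<noteq> w \<circ> transpose r j"
      proof
        assume eq: "simple_transp k \<circ> w = w \<circ> transpose r j"
        have "r \<noteq> j"
        proof
          assume "r = j"
          then have "simple_transp k \<circ> w = w" using eq by simp
          moreover obtain x where "w x = k" using permutes_surj[OF w] by (metis surj_def)
          ultimately show False by (metis comp_apply simple_transp_def transpose_apply_first n_not_Suc_n Suc_eq_plus1)
        qed
        then have "w r \<noteq> w j" using permutes_inj[OF w] by (auto dest: injD)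
        moreover have "simple_transp k (w r) = w j" using fun_cong[OF eq, of r] by simp
        ultimately show False using 3 by (auto simp: simple_transp_def transpose_def split: if_splits)
      qed
      then show ?thesis using 3 by auto
    qed
  qed
  have "(\<Sum>j = 1..Suc N. \<Sum>k = 1..N. if simple_transp k \<circ> w = w \<circ> transpose r j
      then side r j * (if left_descent w k then - int k else int k) else 0) =
      (\<Sum>j = 1..Suc N. \<Sum>k = 1..N. ?g (w j) k)"
    by (intro sum.cong refl) (rule term_eq, simp)
  \<comment> \<open>sum over the value \<open>y = w j\<close> instead of the position \<open>j\<close>\<close>
  also have "\<dots> = (\<Sum>y = 1..Suc N. \<Sum>k = 1..N. ?g y k)"
    by (rule sum.reindex_bij_betw[OF permutes_imp_bij[OF w'], of "\<lambda>y. \<Sum>k = 1..N. ?g y k"])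
  also have "\<dots> = (\<Sum>y = 1..Suc N. if y = w r + 1 then int (w r) else 0) -
      (\<Sum>y = 1..Suc N. if y = w r - 1 then int (w r - 1) else 0)"
  proof (subst sum_subtractf[symmetric], intro sum.cong refl)
    fix y assume y: "y \<in> {1..Suc N}"
    have "(\<Sum>k = 1..N. if k = w r \<and> y = k + 1 then int k else 0) =
        (\<Sum>k = 1..N. if k = w r then (if y = w r + 1 then int (w r) else 0) else 0)"
      by (intro sum.cong) auto
    moreover have "(\<Sum>k = 1..N. if y = k \<and> w r = k + 1 then int k else 0) =
        (\<Sum>k = 1..N. if k = w r - 1 then (if y = w r - 1 then int (w r - 1) else 0) else 0)"
      using wr by (intro sum.cong) auto
    ultimately show "(\<Sum>k = 1..N. ?g y k) =
        (if y = w r + 1 then int (w r) else 0) - (if y = w r - 1 then int (w r - 1) else 0)"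
      using wr y by (auto simp: sum_subtractf)
  qed
  also have "\<dots> = 1" using wr by auto
  finally show ?thesis .
qed

theorem monk_at_ones:
  assumes w: "w permutes {1..N}" and r: "1 \<le> r" "r \<le> N"
  shows "signed_covers N r w = int (perm_length w + 1) * int (num_bounded_pairs w)"
  using w
proof (induction "perm_length w" arbitrary: w rule: less_induct)
  case less
  let ?t = "transpose r"
  let ?c = "\<lambda>v. int (num_bounded_pairs v)"
  \<comment> \<open>\<open>?exc\<close> collects the exceptional pairs: if \<open>k\<close> is not a left descent of \<open>w\<close>, the pair occurs
    only in the expansion for \<open>w\<close>; if it is one, the pair occurs only in the sum for \<open>s\<^sub>k w\<close>, that
    is, in \<open>?reg\<close>, and has to be subtracted.\<close>
  let ?exc = "\<lambda>j k. if simple_transp k \<circ> w = w \<circ> ?t j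
    then side r j * (if left_descent w k then - int k else int k) else 0"
  let ?reg = "\<lambda>j k. if left_descent w k \<and>
      perm_length (simple_transp k \<circ> w \<circ> ?t j) = perm_length (simple_transp k \<circ> w) + 1
    then int k * (side r j * ?c (simple_transp k \<circ> w \<circ> ?t j)) else 0"
  note w = less.prems
  have w': "w permutes {1..Suc N}" by (rule permutes_subset[OF w]) auto
  have first_letter:
    "?c v = (\<Sum>k = 1..N. if left_descent v k then int k * ?c (simple_transp k \<circ> v) else 0)"
    if "v permutes {1..Suc N}" "0 < perm_length v" for v
    unfolding num_bounded_pairs_first_letter[OF that] of_nat_sum
    by (intro sum.cong refl) simp
  have split_term: "(if perm_length (w \<circ> ?t j) = perm_length w + 1 \<and> left_descent (w \<circ> ?t j) k
      then side r j * (int k * ?c (simple_transp k \<circ> (w \<circ> ?t j))) else 0)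
      = ?exc j k * ?c w + ?reg j k" if "1 \<le> j" "1 \<le> k" for j k
  proof (cases "simple_transp k \<circ> w = w \<circ> ?t j")
    case True
    have "w \<circ> ?t j \<circ> ?t j = w" by (simp add: comp_assoc)
    then show ?thesis
      using perm_length_simple_transp_cases[OF w that(2)] left_descent_simple_transp_comp[OF w that(2)]
      by (auto simp: True[symmetric] simp flip: True)
  next
    case False
    then show ?thesis
      using left_descent_cover_exchange[OF w r(1) that False] by (simp add: comp_assoc)
  qed
  have "signed_covers N r w = (\<Sum>j = 1..Suc N. \<Sum>k = 1..N.
      if perm_length (w \<circ> ?t j) = perm_length w + 1 \<and> left_descent (w \<circ> ?t j) k
      then side r j * (int k * ?c (simple_transp k \<circ> (w \<circ> ?t j))) else 0)"
    unfolding signed_covers_def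
  proof (intro sum.cong refl)
    fix j assume j: "j \<in> {1..Suc N}"
    have "w \<circ> ?t j permutes {1..Suc N}"
      using w r j by (intro permutes_comp_transpose) auto
    from first_letter[OF this] show "(if perm_length (w \<circ> ?t j) = perm_length w + 1
        then side r j * ?c (w \<circ> ?t j) else 0) = (\<Sum>k = 1..N.
      if perm_length (w \<circ> ?t j) = perm_length w + 1 \<and> left_descent (w \<circ> ?t j) k
      then side r j * (int k * ?c (simple_transp k \<circ> (w \<circ> ?t j))) else 0)"
      by (auto simp: sum_distrib_left intro!: sum.cong)
  qed
  also have "\<dots> = (\<Sum>j = 1..Suc N. \<Sum>k = 1..N. ?exc j k * ?c w + ?reg j k)"
    by (intro sum.cong refl split_term) auto
  also have "\<dots> = (\<Sum>j = 1..Suc N. \<Sum>k = 1..N. ?exc j k) * ?c w +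
      (\<Sum>k = 1..N. \<Sum>j = 1..Suc N. ?reg j k)"
    unfolding sum.distrib sum_distrib_right
    by (rule arg_cong2[of _ _ _ _ "(+)"]) (rule refl, rule sum.swap)
  also have "(\<Sum>j = 1..Suc N. \<Sum>k = 1..N. ?exc j k) = 1"
    by (rule exceptional_terms_cancel[OF w r])
  also have "(\<Sum>k = 1..N. \<Sum>j = 1..Suc N. ?reg j k) =
      (\<Sum>k = 1..N. int (perm_length w) * (if left_descent w k then int k * ?c (simple_transp k \<circ> w) else 0))"
  proof (intro sum.cong refl)
    fix k assume "k \<in> {1..N}"
    then have k: "1 \<le> k" by simp
    show "(\<Sum>j = 1..Suc N. ?reg j k) =
        int (perm_length w) * (if left_descent w k then int k * ?c (simple_transp k \<circ> w) else 0)"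
    proof (cases "left_descent w k")
      case True
      have "(\<Sum>j = 1..Suc N. ?reg j k) = int k * signed_covers N r (simple_transp k \<circ> w)"
        unfolding signed_covers_def sum_distrib_left by (intro sum.cong refl) (simp add: True)
      also have "signed_covers N r (simple_transp k \<circ> w) =
          int (perm_length (simple_transp k \<circ> w) + 1) * ?c (simple_transp k \<circ> w)"
        using True left_descent_less[OF w k True] k w
        by (intro less.hyps simple_transp_comp_permutes) (auto simp: left_descent_def)
      also have "int k * (int (perm_length (simple_transp k \<circ> w) + 1) * ?c (simple_transp k \<circ> w)) =
          int (perm_length w) * (if left_descent w k then int k * ?c (simple_transp k \<circ> w) else 0)"
        using True perm_length_simple_transp_cases[OF w k] by simp
      finally show ?thesis .
    qed simp
  qed
  also have "\<dots> = int (perm_length w) * ?c w"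
    unfolding sum_distrib_left[symmetric]
    using first_letter[OF w'] by (cases "perm_length w = 0") auto
  finally show ?case by (simp add: algebra_simps)
qed

section \<open>The lex largest inversion\<close>

lemma S_inf_permutes:
  assumes "w \<in> S_inf"
  obtains N where "w permutes {1..N}"
proof -
  have w: "w permutes {1..}" and fin: "finite {i. w i \<noteq> i}" using assms by (auto simp: S_inf_def)
  let ?N = "Max (insert 0 {i. w i \<noteq> i})"
  have "w permutes {1..?N}"
  proof (rule permutes_superset[OF w])
    fix x assume "x \<in> {1..} - {1..?N}"
    then have "\<not> x \<le> Max (insert 0 {i. w i \<noteq> i})" by auto
    then show "w x = x" using fin Max_ge[of "insert 0 {i. w i \<noteq> i}" x] by auto
  qed
  then show ?thesis by (rule that)
qed

text \<open>
  To the right of \<open>r\<close> the permutation \<open>w\<close> is increasing, and \<open>s\<close> is the last position there whose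
  value is below \<open>w(r)\<close>. Hence, in \<open>v\<close>, the values at the positions between \<open>r\<close> and \<open>s\<close> are below
  \<open>v(r) = w(s)\<close>, while for a position \<open>j > s\<close> the value \<open>v(s) = w(r)\<close> lies between \<open>v(r)\<close> and
  \<open>v(j)\<close> and prevents \<open>v t\<^sub>r\<^sub>j\<close> from being a cover.
\<close>

lemma lex_largest_inversion_covers:
  assumes w: "w permutes {1..N}" and lex: "lex_largest_inversion w r s"
  defines "v \<equiv> w \<circ> transpose r s"
  shows "v permutes {1..N}" "1 \<le> r" "s \<le> N" "r < s" "perm_length w = perm_length v + 1"
    and "\<And>j. r < j \<Longrightarrow> perm_length (v \<circ> transpose r j) = perm_length v + 1 \<longleftrightarrow> j = s"
proof -
  have rs: "(r, s) \<in> inversions w"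
    and max: "\<And>i j. (i, j) \<in> inversions w \<Longrightarrow> i < r \<or> i = r \<and> j \<le> s"
    using lex by (auto simp: lex_largest_inversion_def)
  show r1: "1 \<le> r" and sN: "s \<le> N" and rs': "r < s"
    using rs inversions_subset[OF w] by (auto simp: inversions_def)
  show v: "v permutes {1..N}"
    unfolding v_def using w r1 sN rs' by (intro permutes_comp_transpose[OF w]) auto
  have desc: "w s < w r" using rs by (simp add: inversions_def)
  have incr: "w i < w j" if "r < i" "i < j" for i j
  proof -
    have "w i \<noteq> w j" using permutes_inj[OF w] that by (auto dest: injD)
    moreover have "(i, j) \<notin> inversions w" using max[of i j] that by auto
    ultimately show ?thesis using that r1 by (auto simp: inversions_def)
  qed
  have vr: "v r = w s" and vs: "v s = w r" by (simp_all add: v_def)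
  have v_other: "v j = w j" if "j \<noteq> r" "j \<noteq> s" for j
    using that by (simp add: v_def)
  show iff: "perm_length (v \<circ> transpose r j) = perm_length v + 1 \<longleftrightarrow> j = s" if j: "r < j" for j
  proof -
    consider "j < s" | "j = s" | "s < j" by linarith
    then show ?thesis
    proof cases
      case 1
      then have "\<not> v r < v j" using incr[OF j 1] vr v_other[of j] j by simp
      then show ?thesis using perm_length_cover_iff[OF v r1 j] 1 by simp
    next
      case 2
      have "\<not> v r < v m" if "r < m" "m < s" for m
        using incr[OF that] vr v_other[of m] that by simp
      then show ?thesis using perm_length_cover_iff[OF v r1 rs'] 2 desc vr vs by auto
    next
      case 3
      have "w r < w j"
      proof -
        have "(r, j) \<notin> inversions w" using max[of r j] 3 by auto
        moreover have "w r \<noteq> w j" using permutes_inj[OF w] j by (auto dest: injD)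
        ultimately show ?thesis using j r1 by (auto simp: inversions_def)
      qed
      then have "v r < v s \<and> v s < v j" using desc vr vs v_other[of j] 3 j by simp
      then show ?thesis using perm_length_cover_iff[OF v r1 j] 3 rs' by auto
    qed
  qed
  show "perm_length w = perm_length v + 1"
    using iff[OF rs'] by (simp add: v_def comp_assoc)
qed

lemma num_bounded_pairs_transition:
  assumes "w \<in> S_inf" and lex: "lex_largest_inversion w r s"
  defines "v \<equiv> w \<circ> transpose r s"
  shows "num_bounded_pairs w = perm_length w * num_bounded_pairs v +
    (\<Sum>q | 1 \<le> q \<and> q < r \<and> perm_length w = perm_length (v \<circ> transpose q r).
      num_bounded_pairs (v \<circ> transpose q r))"
proof -
  let ?c = "\<lambda>v. int (num_bounded_pairs v)"
  obtain N where w: "w permutes {1..N}" using S_inf_permutes[OF assms(1)] by blast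
  note cov = lex_largest_inversion_covers[OF w lex, folded v_def]
  have rN: "r \<le> N" using cov by simp
  have ws: "v \<circ> transpose r s = w" by (simp add: v_def comp_assoc)
  let ?f = "\<lambda>j. if perm_length (v \<circ> transpose r j) = perm_length v + 1
    then side r j * ?c (v \<circ> transpose r j) else 0"
  have "{1..Suc N} = {1..<r} \<union> ({r} \<union> {r<..Suc N})" using cov by auto
  then have "signed_covers N r v = sum ?f ({1..<r} \<union> ({r} \<union> {r<..Suc N}))"
    unfolding signed_covers_def by simp
  also have "\<dots> = sum ?f {1..<r} + (sum ?f {r} + sum ?f {r<..Suc N})"
    by (subst sum.union_disjoint; auto)+
  also have "sum ?f {r<..Suc N} = (\<Sum>j\<in>{r<..Suc N}. if j = s then ?c w else 0)"
    using cov(4,6) ws by (intro sum.cong refl) (auto simp: side_def)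
  also have "\<dots> = ?c w" using cov by simp
  also have "sum ?f {1..<r} =
      - (\<Sum>q\<in>{1..<r}. if perm_length w = perm_length (v \<circ> transpose q r) then ?c (v \<circ> transpose q r) else 0)"
    unfolding sum_negf[symmetric] using cov(5)
    by (intro sum.cong refl) (auto simp: side_def transpose_commute)
  also have "(\<Sum>q\<in>{1..<r}. if perm_length w = perm_length (v \<circ> transpose q r) then ?c (v \<circ> transpose q r) else 0)
      = (\<Sum>q\<in>{q \<in> {1..<r}. perm_length w = perm_length (v \<circ> transpose q r)}. ?c (v \<circ> transpose q r))"
    by (rule sum.inter_filter[symmetric]) simp
  also have "{q \<in> {1..<r}. perm_length w = perm_length (v \<circ> transpose q r)} =
      {q. 1 \<le> q \<and> q < r \<and> perm_length w = perm_length (v \<circ> transpose q r)}"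
    by auto
  also have "sum ?f {r} = 0" by simp
  finally have "?c w = int (perm_length w) * ?c v +
      (\<Sum>q | 1 \<le> q \<and> q < r \<and> perm_length w = perm_length (v \<circ> transpose q r). ?c (v \<circ> transpose q r))"
    unfolding monk_at_ones[OF cov(1,2) rN] cov(5)[symmetric] by linarith
  then show ?thesis
    by (simp only: of_nat_sum[symmetric] of_nat_mult[symmetric] of_nat_add[symmetric] of_nat_eq_iff)
qed

theorem theorem4p2:
  "(\<forall>\<pi>\<in>S_inf. \<forall>p r s \<nu>.
      perm_length \<pi> = p \<and> p > 0 \<and> lex_largest_inversion \<pi> r s \<and> \<nu> = \<pi> \<circ> transpose r s \<longrightarrow>
      num_bounded_pairs \<pi> =
        p * num_bounded_pairs \<nu> +
        (\<Sum>q | 1 \<le> q \<and> q < r \<and> perm_length \<pi> = perm_length (\<nu> \<circ> transpose q r).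
           num_bounded_pairs (\<nu> \<circ> transpose q r))) \<and>
   num_bounded_pairs id = 1"
  using num_bounded_pairs_transition num_bounded_pairs_id by blast

end
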